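(* Let $S=\langle L,\leq,\top,\bot,\Box,\boxtimes\rangle$ be a meet APS such that for all $x,y,z\in L$, if $x\leq\Box y$ and $x\leq\boxtimes(y\land z)$, then $x\leq\boxtimes z$. Let $\triangle v$ be a one-variable meet APS term. Suppose that, for every subterm of $\triangle v$ of the form $\triangle_0 v\land\triangle_1 v$, the degrees $d(\triangle_0)$ and $d(\triangle_1)$ have the same parity. If $d(\triangle)$ is even, then $\mathsf{E}_S(\triangle)$ holds.
   Context: An abstract provability structure (APS) is a tuple $S=\langle L,\leq,\top,\bot,\Box,\boxtimes\rangle$ where $L$ is a nonempty set, $\leq$ is a partial order on $L$, $\top,\bot\in L$, and $\Box,\boxtimes$ are unary operations on $L$ such that for all $x,y\in L$: (C1) if $x\leq y$ then $\Box x\leq\Box y$ and $\boxtimes y\leq\boxtimes x$; (C2) $\top\leq\boxtimes\bot$; (C3) if $x\leq\Box y$ and $x\leq\boxtimes y$ then $x\leq\boxtimes\top$; (C4) $\boxtimes x\leq\Box\boxtimes x$; (C5) $x\leq\top$. (It is not assumed that $\bot$ is the least element.) A meet APS is an APS for which $\langle L,\leq\rangle$ is a meet-semilattice; $x\land y$ denotes the meet. A one-variable meet APS term $\triangle v$ is generated from the variable $v$ by finitely many applications of $\Box$, $\boxtimes$, and $\land$; it induces a unary operation $x\mapsto\triangle x$ on $L$. Its degree is defined recursively by $d(v)=0$, $d(\Box\triangle_0)=d(\triangle_0)$, $d(\boxtimes\triangle_0)=d(\triangle_0)+1$, $d(\triangle_0\land\triangle_1)=\max\{d(\triangle_0),d(\triangle_1)\}$.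 $\mathsf{E}_S(\triangle)$ means "$\triangle v$ has a fixed point in $S$", i.e. there is $p\in L$ with $\triangle p=p$. *)

theory Defs
  imports "HOL-Algebra.Lattice"
begin

text \<open>The carrier and the order come from \<^typ>\<open>'a gorder\<close>; its equality component is
  forced to be \<open>(=)\<close> by \<^locale>\<open>partial_order\<close>. The distinguished elements \<open>tt\<close> and \<open>ff\<close>
  (\<open>ff\<close> need not be a least element) are fields of their own, unrelated to the
  extremal elements \<^const>\<open>top\<close> and \<^const>\<open>bottom\<close> that the library derives from the order.\<close>

record 'a aps = "'a gorder" +
  tt :: 'a
  ff :: 'a
  box :: "'a \<Rightarrow> 'a"
  boxtimes :: "'a \<Rightarrow> 'a"

locale abstract_provability_structure = partial_order S
  for S :: "('a, 'm) aps_scheme" (structure) +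
  assumes tt_closed: "tt S \<in> carrier S"
    and ff_closed: "ff S \<in> carrier S"
    and box_closed: "x \<in> carrier S \<Longrightarrow> box S x \<in> carrier S"
    and boxtimes_closed: "x \<in> carrier S \<Longrightarrow> boxtimes S x \<in> carrier S"
    and box_mono: "\<lbrakk>x \<in> carrier S; y \<in> carrier S; x \<sqsubseteq> y\<rbrakk> \<Longrightarrow> box S x \<sqsubseteq> box S y"
    and boxtimes_antimono:
      "\<lbrakk>x \<in> carrier S; y \<in> carrier S; x \<sqsubseteq> y\<rbrakk> \<Longrightarrow> boxtimes S y \<sqsubseteq> boxtimes S x"
    and tt_le_boxtimes_ff: "tt S \<sqsubseteq> boxtimes S (ff S)"
    and le_boxtimes_tt:
      "\<lbrakk>x \<in> carrier S; y \<in> carrier S; x \<sqsubseteq> box S y; x \<sqsubseteq> boxtimes S y\<rbrakk>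
        \<Longrightarrow> x \<sqsubseteq> boxtimes S (tt S)"
    and boxtimes_le_box_boxtimes: "x \<in> carrier S \<Longrightarrow> boxtimes S x \<sqsubseteq> box S (boxtimes S x)"
    and le_tt: "x \<in> carrier S \<Longrightarrow> x \<sqsubseteq> tt S"

locale meet_aps = abstract_provability_structure S + lower_semilattice S
  for S :: "('a, 'm) aps_scheme" (structure)

datatype aps_term = Var | Box aps_term | Boxtimes aps_term | Meet aps_term aps_term

primrec term_op :: "('a, 'm) aps_scheme \<Rightarrow> aps_term \<Rightarrow> 'a \<Rightarrow> 'a" where
  "term_op S Var x = x"
| "term_op S (Box t) x = box S (term_op S t x)"
| "term_op S (Boxtimes t) x = boxtimes S (term_op S t x)"
| "term_op S (Meet t u) x = term_op S t x \<sqinter>\<^bsub>S\<^esub> term_op S u x"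

primrec degree :: "aps_term \<Rightarrow> nat" where
  "degree Var = 0"
| "degree (Box t) = degree t"
| "degree (Boxtimes t) = degree t + 1"
| "degree (Meet t u) = max (degree t) (degree u)"

primrec subterms :: "aps_term \<Rightarrow> aps_term set" where
  "subterms Var = {Var}"
| "subterms (Box t) = insert (Box t) (subterms t)"
| "subterms (Boxtimes t) = insert (Boxtimes t) (subterms t)"
| "subterms (Meet t u) = insert (Meet t u) (subterms t \<union> subterms u)"

definition has_fixed_point :: "('a, 'm) aps_scheme \<Rightarrow> aps_term \<Rightarrow> bool" where
  "has_fixed_point S t \<longleftrightarrow> (\<exists>p \<in> carrier S. term_op S t p = p)"

end

theory Submission
  imports Defs
begin

text \<open>Put \<open>b = \<boxtimes>\<top>\<close> and \<open>c = \<boxtimes>b\<close>; then \<open>\<boxtimes>c = b\<close>, so \<open>\<boxtimes>\<close> interchanges the two. The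
  cancellation hypothesis extends this from \<open>b\<close> to the class of those \<open>x \<ge> b\<close> with
  \<open>\<boxtimes>x = c\<close>, which is closed under \<open>\<box>\<close> and meets, while \<open>\<boxtimes>x = b\<close> for all \<open>x \<ge> c\<close>. Hence at
  a point \<open>p = \<box>\<^sup>K c\<close> each outermost \<open>\<boxtimes>\<close>-subterm of a term of even degree has the value \<open>c\<close>.
  Since \<open>c \<le> \<box>c \<le> \<box>\<box>c \<le> \<dots>\<close>, the value of the whole term is again some \<open>\<box>\<^sup>f\<^sup>(\<^sup>K\<^sup>) c\<close>, where \<open>f\<close>
  is monotone, and bounded as soon as \<open>\<boxtimes>\<close> occurs; so \<open>f\<close> has a fixed point. Without
  \<open>\<boxtimes>\<close>, the term fixes \<open>\<top>\<close>.\<close>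

text \<open>Knaster-Tarski style: the bound gives a greatest \<open>k\<close> with
  \<open>k \<le> f k\<close>, and by monotonicity \<open>f k\<close> has the same property.\<close>

lemma bounded_mono_nat_fixed_point:
  fixes f :: "nat \<Rightarrow> nat"
  assumes "mono f" and bound: "\<And>k. f k \<le> m"
  shows "\<exists>k. f k = k"
proof -
  define k where "k = (GREATEST k. k \<le> f k)"
  have le_m: "\<And>j. j \<le> f j \<Longrightarrow> j \<le> m"
    using bound le_trans by blast
  have k: "k \<le> f k"
    unfolding k_def using GreatestI_nat[of "\<lambda>k. k \<le> f k" 0 m] le_m by blast
  then have "f k \<le> f (f k)"
    using \<open>mono f\<close> by (simp add: monoD)
  then have "f k \<le> k"
    unfolding k_def using Greatest_le_nat[of "\<lambda>k. k \<le> f k" _ m] le_m by blast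
  with k show ?thesis
    by (intro exI[of _ k]) simp
qed

context abstract_provability_structure
begin

definition b :: 'a where "b = boxtimes S (tt S)"
definition c :: 'a where "c = boxtimes S b"

lemma b_closed: "b \<in> carrier S"
  by (simp add: b_def boxtimes_closed tt_closed)

lemma c_closed: "c \<in> carrier S"
  by (simp add: c_def boxtimes_closed b_closed)

lemma b_le_boxtimes: "x \<in> carrier S \<Longrightarrow> b \<sqsubseteq> boxtimes S x"
  unfolding b_def by (simp add: boxtimes_antimono le_tt tt_closed)

lemma b_le_box_b: "b \<sqsubseteq> box S b"
  unfolding b_def by (simp add: boxtimes_le_box_boxtimes tt_closed)

lemma c_le_box_c: "c \<sqsubseteq> box S c"
  by (simp add: c_def boxtimes_le_box_boxtimes b_closed)

lemma b_le_c: "b \<sqsubseteq> c"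
  by (simp add: c_def b_le_boxtimes b_closed)

lemma boxtimes_c: "boxtimes S c = b"
proof -
  let ?d = "boxtimes S c"
  have d: "?d \<in> carrier S"
    by (simp add: boxtimes_closed c_closed)
  have "?d \<sqsubseteq> c"
    by (metis c_def boxtimes_antimono b_le_c b_closed c_closed)
  then have "?d \<sqsubseteq> boxtimes S ?d"
    by (simp add: boxtimes_antimono c_closed d)
  \<comment> \<open>C4 gives \<open>?d \<sqsubseteq> box S ?d\<close>, so C3 applies with both
    variables equal to \<open>?d\<close>.\<close>
  then have "?d \<sqsubseteq> b"
    unfolding b_def using boxtimes_le_box_boxtimes c_closed d le_boxtimes_tt by blast
  then show ?thesis
    by (simp add: le_antisym b_le_boxtimes b_closed c_closed d)
qed

lemma boxtimes_eq_b:
  assumes "x \<in> carrier S" "c \<sqsubseteq> x"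
  shows "boxtimes S x = b"
  using assms boxtimes_antimono[of c x] boxtimes_c
  by (simp add: le_antisym b_le_boxtimes boxtimes_closed b_closed c_closed)

text \<open>C2 makes \<top> a value of \<open>boxtimes S\<close>, so C4 applies to it.\<close>

lemma box_tt: "box S (tt S) = tt S"
proof -
  have "boxtimes S (ff S) = tt S"
    by (intro le_antisym le_tt tt_le_boxtimes_ff boxtimes_closed ff_closed tt_closed)
  then have "tt S \<sqsubseteq> box S (tt S)"
    using boxtimes_le_box_boxtimes[OF ff_closed] by simp
  then show ?thesis
    by (simp add: le_antisym le_tt box_closed tt_closed)
qed

abbreviation boxc :: "nat \<Rightarrow> 'a" where "boxc n \<equiv> (box S ^^ n) c"

lemma boxc_closed: "boxc n \<in> carrier S"
  by (induction n) (auto simp: box_closed c_closed)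

lemma boxc_le_Suc: "boxc n \<sqsubseteq> boxc (Suc n)"
  by (induction n) (auto simp: c_le_box_c box_mono boxc_closed box_closed)

lemma boxc_mono: "i \<le> j \<Longrightarrow> boxc i \<sqsubseteq> boxc j"
proof (induction j rule: dec_induct)
  case base
  show ?case by (simp add: boxc_closed)
next
  case (step n)
  show ?case
    by (rule le_trans[OF step.IH boxc_le_Suc]) (rule boxc_closed)+
qed

text \<open>Collects the values of terms of odd degree. The lower bound \<open>b\<close> yields one
  half of the equation by antitonicity.\<close>

definition boxtimes_c_class :: "'a set" where
  "boxtimes_c_class = {x \<in> carrier S. b \<sqsubseteq> x \<and> boxtimes S x = c}"

lemma b_in_class: "b \<in> boxtimes_c_class"
  by (simp add: boxtimes_c_class_def b_closed c_def)

lemma boxtimes_c_classI: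
  assumes "x \<in> carrier S" "b \<sqsubseteq> x" "c \<sqsubseteq> boxtimes S x"
  shows "x \<in> boxtimes_c_class"
proof -
  have "boxtimes S x \<sqsubseteq> c"
    unfolding c_def by (rule boxtimes_antimono) (use assms b_closed in auto)
  then show ?thesis
    using assms by (simp add: boxtimes_c_class_def le_antisym boxtimes_closed c_closed)
qed

end

fun boxc_index :: "nat \<Rightarrow> aps_term \<Rightarrow> nat" where
  "boxc_index K Var = K"
| "boxc_index K (Box t) = Suc (boxc_index K t)"
| "boxc_index K (Boxtimes t) = 0"
| "boxc_index K (Meet t u) = min (boxc_index K t) (boxc_index K u)"

lemma mono_boxc_index: "mono (\<lambda>K. boxc_index K t)"
  by (induction t) (auto simp: mono_def intro: min.coboundedI1 min.coboundedI2)

text \<open>Following operands of positive degree leads to a \<open>Boxtimes\<close>, which resets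
  the index to 0; above it only \<open>Box\<close> raises the index.\<close>

lemma boxc_index_le_size: "degree t > 0 \<Longrightarrow> boxc_index K t \<le> size t"
  by (induction t) (auto simp: min_le_iff_disj max_def split: if_splits)

context meet_aps
begin

lemma meet_idem: "x \<in> carrier S \<Longrightarrow> x \<sqinter> x = x"
  by (intro le_antisym meet_left meet_le) auto

lemma meet_eq_left:
  assumes "x \<in> carrier S" "y \<in> carrier S" "x \<sqsubseteq> y"
  shows "x \<sqinter> y = x" "y \<sqinter> x = x"
  using assms by (auto intro!: le_antisym meet_left meet_right meet_le)

lemma meet_boxc: "boxc i \<sqinter> boxc j = boxc (min i j)"
  by (cases "i \<le> j") (simp_all add: boxc_closed boxc_mono meet_eq_left)

lemma term_op_degree_0: "degree t = 0 \<Longrightarrow> term_op S t (tt S) = tt S"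
  by (induction t) (auto simp: box_tt meet_idem tt_closed)

end

locale cancellative_meet_aps = meet_aps +
  assumes boxtimes_cancel: "\<lbrakk>x \<in> carrier S; y \<in> carrier S; z \<in> carrier S;
            x \<sqsubseteq> box S y; x \<sqsubseteq> boxtimes S (y \<sqinter> z)\<rbrakk> \<Longrightarrow> x \<sqsubseteq> boxtimes S z"
begin

lemma box_in_class:
  assumes "x \<in> boxtimes_c_class"
  shows "box S x \<in> boxtimes_c_class"
proof (rule boxtimes_c_classI)
  have x: "x \<in> carrier S" "b \<sqsubseteq> x" "boxtimes S x = c"
    using assms by (auto simp: boxtimes_c_class_def)
  show bx: "box S x \<in> carrier S"
    by (simp add: box_closed x)
  show "b \<sqsubseteq> box S x"
    by (rule le_trans[OF b_le_box_b box_mono]) (use x bx b_closed box_closed in auto)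
  have m: "c \<sqinter> box S x \<in> carrier S"
    by (simp add: meet_closed c_closed bx)
  \<comment> \<open>C3 at \<open>x\<close>, since \<open>c\<close> is \<open>boxtimes S x\<close>.
    Applying \<open>boxtimes S\<close> then prepares for cancelling \<open>c\<close>, which is
    allowed by \<open>c \<sqsubseteq> box S c\<close>.\<close>
  have "c \<sqinter> box S x \<sqsubseteq> b"
    unfolding b_def
    by (rule le_boxtimes_tt[OF m x(1)]) (simp_all add: x meet_left meet_right c_closed bx)
  then have "c \<sqsubseteq> boxtimes S (c \<sqinter> box S x)"
    using boxtimes_antimono[OF m b_closed] by (simp add: c_def)
  then show "c \<sqsubseteq> boxtimes S (box S x)"
    using boxtimes_cancel[OF c_closed c_closed bx c_le_box_c] by blast
qed

lemma meet_in_class: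
  assumes "x \<in> boxtimes_c_class" "y \<in> boxtimes_c_class"
  shows "x \<sqinter> y \<in> boxtimes_c_class"
proof (rule boxtimes_c_classI)
  have x: "x \<in> carrier S" "b \<sqsubseteq> x" "boxtimes S x = c" and y: "y \<in> carrier S" "b \<sqsubseteq> y"
    using assms by (auto simp: boxtimes_c_class_def)
  show m: "x \<sqinter> y \<in> carrier S"
    by (simp add: meet_closed x y)
  show "b \<sqsubseteq> x \<sqinter> y"
    by (simp add: meet_le x y b_closed)
  show "c \<sqsubseteq> boxtimes S (x \<sqinter> y)"
    using boxtimes_antimono[OF m x(1)] meet_left[OF x(1) y(1)] by (simp add: x)
qed

text \<open>Exact values are tracked in even degree only; in odd degree, class membership is all
  that the next \<open>Boxtimes\<close> needs. The parity condition keeps meets from mixing the two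
  cases.\<close>

lemma term_op_boxc:
  assumes "\<And>t0 t1. Meet t0 t1 \<in> subterms t \<Longrightarrow> even (degree t0) \<longleftrightarrow> even (degree t1)"
  shows "if even (degree t) then term_op S t (boxc K) = boxc (boxc_index K t)
         else term_op S t (boxc K) \<in> boxtimes_c_class"
  using assms
proof (induction t)
  case Var
  show ?case by simp
next
  case (Box t)
  then show ?case by (auto simp: box_in_class split: if_splits)
next
  case (Boxtimes t)
  have IH: "if even (degree t) then term_op S t (boxc K) = boxc (boxc_index K t)
            else term_op S t (boxc K) \<in> boxtimes_c_class"
    using Boxtimes by simp
  show ?case
  proof (cases "even (degree t)")
    case True
    have "boxtimes S (boxc n) = b" for n
      using boxc_mono[of 0 n] by (simp add: boxtimes_eq_b boxc_closed)
    with IH True show ?thesis by (simp add: b_in_class)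
  next
    case False
    with IH show ?thesis by (simp add: boxtimes_c_class_def)
  qed
next
  case (Meet t u)
  have parity: "even (degree t) \<longleftrightarrow> even (degree u)"
    using Meet.prems[of t u] by simp
  then have "even (degree (Meet t u)) \<longleftrightarrow> even (degree t)"
    by (simp add: max_def)
  with Meet parity show ?case
    by (auto simp: meet_boxc meet_in_class split: if_splits)
qed

end

theorem theorem7p12:
  fixes S :: "('a, 'm) aps_scheme" (structure)
    and t :: aps_term
  assumes "meet_aps S"
    and "\<And>x y z. \<lbrakk>x \<in> carrier S; y \<in> carrier S; z \<in> carrier S;
            x \<sqsubseteq> box S y; x \<sqsubseteq> boxtimes S (y \<sqinter> z)\<rbrakk> \<Longrightarrow> x \<sqsubseteq> boxtimes S z"
    and "\<And>t0 t1. Meet t0 t1 \<in> subterms t \<Longrightarrow> even (degree t0) \<longleftrightarrow> even (degree t1)"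
    and "even (degree t)"
  shows "has_fixed_point S t"
proof -
  interpret cancellative_meet_aps S
    using assms(1,2) by (intro cancellative_meet_aps.intro cancellative_meet_aps_axioms.intro)
  show ?thesis
  \<comment> \<open>In degree 0 the index may be unbounded: for \<open>Box Var\<close> it is
    \<open>Suc K\<close>, which never equals \<open>K\<close>.\<close>
  proof (cases "degree t = 0")
    case True
    then show ?thesis
      unfolding has_fixed_point_def using term_op_degree_0 tt_closed by blast
  next
    case False
    then obtain K where "boxc_index K t = K"
      using bounded_mono_nat_fixed_point[OF mono_boxc_index boxc_index_le_size] by blast
    then have "term_op S t (boxc K) = boxc K"
      using term_op_boxc[of t K, OF assms(3)] assms(4) by simp
    then show ?thesis
      unfolding has_fixed_point_def using boxc_closed by blast
  qed
qed

end
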